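(* Let $E,F$ be Banach spaces, $U\subset E$ open, $g:U\to F$ a $C^1$ map, $f:U\to\mathbb{R}$ a $C^1$ (not necessarily linear) functional, $y_0\in F$ a regular value of $g$, and $S=g^{-1}(y_0)$ (a regular constraint). If $x\in S$ is a critical point of $f|_S$, then the Lagrange multiplier at $x$ is unique, i.e. there is exactly one $L\in F^*$ with $f'(x)-L\circ g'(x)=0$.
   Context: $g'(x),f'(x)$ are Fréchet derivatives, $N(\cdot)$ denotes null space. A point $x\in U$ is a regular point of $g$ if $g'(x)$ is surjective and $N(g'(x))$ is complemented (splits) in $E$; $y_0\in F$ is a regular value of $g$ if $g^{-1}(y_0)$ is empty or consists only of regular points. In that case $S=g^{-1}(y_0)$ is a $C^1$ submanifold of $U$ with $T_xS=N(g'(x))$ for $x\in S$ (known result). A point $x$ is a critical point of $f|_S$ if $x\in S$ and, for every $C^1$ curve $c:(-\varepsilon,\varepsilon)\to U$ with values in $S$ and $c(0)=x$, one has $\frac{d}{dt}f(c(t))|_{t=0}=0$. A Lagrange multiplier at $x\in S$ is an $L\in F^*$ satisfying the Euler equations $f'(x)-L\circ g'(x)=0$, $g(x)=y_0$. *)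

theory Defs
  imports "HOL-Analysis.Analysis"
begin

text \<open>
  Maps on an open set \<open>U\<close> are total functions of which only the values on \<open>U\<close> matter, and the
  dual space of \<open>'b\<close> is \<open>'b \<Rightarrow>\<^sub>L real\<close>. The library's \<open>frechet_derivative\<close> is meaningful only at
  points of differentiability, so the notions below presuppose maps that are \<open>C1_on\<close> \<open>U\<close>.
\<close>

text \<open>
  Analogue, for an open subset of a normed space, of the library's \<open>C1_differentiable_on\<close>
  (whose domain is the real line). Continuity of \<open>f'\<close> is with respect to the operator norm.
\<close>

definition C1_on :: "('a::real_normed_vector \<Rightarrow> 'b::real_normed_vector) \<Rightarrow> 'a set \<Rightarrow> bool"
  where "C1_on f U \<longleftrightarrow>
    (\<exists>f' :: 'a \<Rightarrow> 'a \<Rightarrow>\<^sub>L 'b.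
      (\<forall>x\<in>U. (f has_derivative blinfun_apply (f' x)) (at x)) \<and> continuous_on U f')"

definition null_space :: "('a::real_vector \<Rightarrow> 'b::real_vector) \<Rightarrow> 'a set"
  where "null_space D = {v. D v = 0}"

definition complemented :: "'a::real_normed_vector set \<Rightarrow> bool"
  where "complemented V \<longleftrightarrow> subspace V \<and> closed V \<and>
    (\<exists>W. subspace W \<and> closed W \<and> V \<inter> W = {0} \<and> {v + w | v w. v \<in> V \<and> w \<in> W} = UNIV)"

definition level_set :: "'a set \<Rightarrow> ('a \<Rightarrow> 'b) \<Rightarrow> 'b \<Rightarrow> 'a set"
  where "level_set U g y0 = {x \<in> U. g x = y0}"

definition regular_point ::
    "'a::real_normed_vector set \<Rightarrow> ('a \<Rightarrow> 'b::real_normed_vector) \<Rightarrow> 'a \<Rightarrow> bool"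
  where "regular_point U g x \<longleftrightarrow> x \<in> U \<and> surj (frechet_derivative g (at x)) \<and>
    complemented (null_space (frechet_derivative g (at x)))"

definition regular_value ::
    "'a::real_normed_vector set \<Rightarrow> ('a \<Rightarrow> 'b::real_normed_vector) \<Rightarrow> 'b \<Rightarrow> bool"
  where "regular_value U g y0 \<longleftrightarrow> (\<forall>x \<in> level_set U g y0. regular_point U g x)"

definition critical_point_on ::
    "('a::real_normed_vector \<Rightarrow> real) \<Rightarrow> 'a set \<Rightarrow> 'a \<Rightarrow> bool"
  where "critical_point_on f S x \<longleftrightarrow> x \<in> S \<and>
    (\<forall>\<epsilon>>0. \<forall>c :: real \<Rightarrow> 'a.
      c C1_differentiable_on {-\<epsilon><..<\<epsilon>} \<longrightarrow> c ` {-\<epsilon><..<\<epsilon>} \<subseteq> S \<longrightarrow> c 0 = x \<longrightarrow>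
      ((\<lambda>t. f (c t)) has_real_derivative 0) (at 0))"

definition lagrange_multiplier ::
    "'a::real_normed_vector set \<Rightarrow> ('a \<Rightarrow> real) \<Rightarrow> ('a \<Rightarrow> 'b::real_normed_vector) \<Rightarrow> 'b \<Rightarrow> 'a \<Rightarrow>
      ('b \<Rightarrow>\<^sub>L real) \<Rightarrow> bool"
  where "lagrange_multiplier U f g y0 x L \<longleftrightarrow> x \<in> U \<and> g x = y0 \<and>
    (\<forall>v. frechet_derivative f (at x) v - blinfun_apply L (frechet_derivative g (at x) v) = 0)"

end

theory Submission
  imports Defs
begin

text \<open>
  Write \<open>D = g'(x)\<close>. Since \<open>D\<close> is onto with split kernel, the closed graph theorem gives a bounded
  right inverse \<open>A\<close> of \<open>D\<close>. The map \<open>\<phi>(z) = z - x - A D (z - x) + A (g(z) - y0)\<close> has derivative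
  \<open>id\<close> at \<open>x\<close> and satisfies \<open>D (\<phi>(z)) = g(z) - y0\<close>, so its local inverse carries the
  segment \<open>t v\<close> with \<open>D v = 0\<close> to a curve in the level set with velocity \<open>v\<close>; criticality then
  says that \<open>f'(x)\<close> vanishes on the kernel of \<open>D\<close>. Hence \<open>f'(x) = f'(x) A D\<close>, so \<open>L = f'(x) A\<close>
  is a multiplier, and surjectivity of \<open>D\<close> leaves no other choice.
\<close>

section \<open>Closed graph theorem\<close>

text \<open>By Baire category in the complete domain, the closure of some set
  \<open>{x. norm (T x) \<le> real n}\<close> contains a ball. After centring and rescaling, each
  \<open>y\<close> is approximated to within half its norm by a point whose image is at most
  \<open>C * norm y\<close>. Repeating this on the remainders writes \<open>y\<close> as a series
  whose image converges absolutely, and closedness of the graph identifies that sum with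
  \<open>T y\<close>.\<close>

theorem closed_graph_theorem:
  fixes T :: "'a::banach \<Rightarrow> 'b::banach"
  assumes "linear T"
    and closed_graph: "\<And>X x y. X \<longlonglongrightarrow> x \<Longrightarrow> (\<lambda>n. T (X n)) \<longlonglongrightarrow> y \<Longrightarrow> T x = y"
  shows "bounded_linear T"
proof -
  interpret linear T by fact
  define B where "B n = closure {x. norm (T x) \<le> real n}" for n :: nat
  have "\<exists>n. x \<in> B n" for x
    using real_arch_simple[of "norm (T x)"] closure_subset by (fastforce simp: B_def)
  then have cover: "\<Union>(range B) = UNIV" by auto
  have "\<exists>n. interior (B n) \<noteq> {}"
  proof (rule ccontr)
    assume "\<not> ?thesis"
    then have "closedin euclidean C \<and> euclidean interior_of C = {}" if "C \<in> range B" for C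
      using that by (auto simp: B_def)
    then have "euclidean interior_of \<Union>(range B) = {}"
      by (intro Baire_category_alt disjI1 completely_metrizable_space_euclidean) auto
    then show False by (simp add: cover)
  qed
  then obtain n x0 where "x0 \<in> interior (B n)"
    by blast
  then obtain r where "r > 0" and r: "cball x0 r \<subseteq> B n"
    by (meson mem_interior_cball)
  \<comment> \<open>The ball is moved to the origin by subtracting an approximant of
    \<open>x0\<close> from one of \<open>x0 + y\<close>; this doubles the bound
    \<open>real n\<close> and adds two errors of \<open>r / 4\<close>.\<close>
  have unit: "\<exists>z. norm (T z) \<le> 2 * real n \<and> norm (y - z) \<le> r / 2" if "norm y \<le> r" for y
  proof -
    have "x0 + y \<in> B n" "x0 \<in> B n"
      using that r \<open>r > 0\<close> by (auto simp: dist_norm)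
    then obtain a b where ab: "norm (T a) \<le> real n" "norm (T b) \<le> real n"
      "dist a (x0 + y) < r / 4" "dist b x0 < r / 4"
      unfolding B_def closure_approachable using \<open>r > 0\<close>
      by (metis (mono_tags, lifting) mem_Collect_eq zero_less_divide_iff zero_less_numeral)
    have "norm (T (a - b)) \<le> 2 * real n"
      using ab norm_triangle_ineq4[of "T a" "T b"] by (simp add: diff)
    moreover have "y - (a - b) = (b - x0) - (a - (x0 + y))"
      by simp
    then have "norm (y - (a - b)) \<le> norm (b - x0) + norm (a - (x0 + y))"
      by (simp only: norm_triangle_ineq4)
    then have "norm (y - (a - b)) \<le> r / 2"
      using ab(3,4) by (simp only: dist_norm)
    ultimately show ?thesis
      by blast
  qed
  define C where "C = 2 * real n / r"
  have "\<exists>z. norm (T z) \<le> C * norm y \<and> norm (y - z) \<le> norm y / 2" for y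
  proof (cases "y = 0")
    case True
    then show ?thesis by (intro exI[of _ 0]) (simp add: zero)
  next
    case False
    \<comment> \<open>Homogeneity: \<open>y\<close> is stretched to norm \<open>r\<close>,
      approximated there, and the approximant is shrunk back by \<open>s\<close>.\<close>
    define s where "s = r / norm y"
    have "s > 0" and sy: "s * norm y = r" using False \<open>r > 0\<close> by (simp_all add: s_def)
    then have "norm (s *\<^sub>R y) \<le> r" by simp
    then obtain z where z: "norm (T z) \<le> 2 * real n" "norm (s *\<^sub>R y - z) \<le> r / 2"
      using unit by blast
    have "norm (T (z /\<^sub>R s)) \<le> C * norm y"
    proof -
      have "norm (T (z /\<^sub>R s)) = norm (T z) / s"
        using \<open>s > 0\<close> by (simp add: scale divide_inverse_commute)
      also have "\<dots> \<le> 2 * real n / s"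
        using z(1) \<open>s > 0\<close> by (simp add: divide_right_mono)
      also have "\<dots> = C * norm y"
        using \<open>s > 0\<close> \<open>r > 0\<close> False by (simp add: C_def s_def)
      finally show ?thesis .
    qed
    moreover have "y - z /\<^sub>R s = (s *\<^sub>R y - z) /\<^sub>R s"
      using \<open>s > 0\<close> by (simp add: scaleR_diff_right)
    then have "norm (y - z /\<^sub>R s) = norm (s *\<^sub>R y - z) / s"
      using \<open>s > 0\<close> by (simp add: divide_inverse_commute)
    then have "norm (y - z /\<^sub>R s) \<le> r / 2 / s"
      using z(2) \<open>s > 0\<close> by (simp only: divide_right_mono less_imp_le)
    then have "norm (y - z /\<^sub>R s) \<le> norm y / 2"
      using \<open>r > 0\<close> by (simp add: s_def)
    ultimately show ?thesis by blast
  qed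
  then obtain p where Tp: "\<And>y. norm (T (p y)) \<le> C * norm y"
    and p: "\<And>y. norm (y - p y) \<le> norm y / 2"
    by metis
  have "C \<ge> 0" using \<open>r > 0\<close> by (simp add: C_def)
  have "norm (T y) \<le> norm y * (2 * C)" for y
  proof -
    \<comment> \<open>\<open>Y k\<close> is the remainder after \<open>k\<close> approximations.
      Remainders halve at each step, and the corrections \<open>p (Y k)\<close> telescope.\<close>
    define Y where "Y k = ((\<lambda>y. y - p y) ^^ k) y" for k
    have Y: "norm (Y k) \<le> norm y * (1/2) ^ k" for k
    proof (induction k)
      case (Suc k)
      then show ?case using p[of "Y k"] by (simp add: Y_def)
    qed (simp add: Y_def)
    have le: "norm (T (p (Y k))) \<le> C * norm y * (1/2) ^ k" for k
      using Tp[of "Y k"] mult_left_mono[OF Y[of k] \<open>C \<ge> 0\<close>] by simp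
    have sums: "(\<lambda>k. C * norm y * (1/2) ^ k) sums (C * norm y * 2)"
      using sums_mult[OF geometric_sums[of "1/2 :: real"], of "C * norm y"] by simp
    have norm_summable: "summable (\<lambda>k. norm (T (p (Y k))))"
      by (rule summable_comparison_test'[OF sums_summable[OF sums]]) (use le in simp)
    have partial: "(\<Sum>k<m. p (Y k)) = y - Y m" for m
      by (induction m) (auto simp: Y_def)
    have "Y \<longlonglongrightarrow> 0"
      by (rule Lim_null_comparison[of _ "\<lambda>k. norm y * (1/2) ^ k"])
        (use Y in \<open>auto intro!: tendsto_mult_right_zero LIMSEQ_power_zero\<close>)
    then have "(\<lambda>m. \<Sum>k<m. p (Y k)) \<longlonglongrightarrow> y"
      unfolding partial using tendsto_diff[OF tendsto_const, of Y 0] by fastforce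
    moreover have "(\<lambda>m. T (\<Sum>k<m. p (Y k))) \<longlonglongrightarrow> (\<Sum>k. T (p (Y k)))"
      unfolding sum using summable_LIMSEQ summable_norm_cancel[OF norm_summable] by blast
    ultimately have "T y = (\<Sum>k. T (p (Y k)))"
      by (rule closed_graph)
    also have "norm \<dots> \<le> (\<Sum>k. norm (T (p (Y k))))"
      by (rule summable_norm[OF norm_summable])
    also have "\<dots> \<le> (\<Sum>k. C * norm y * (1/2) ^ k)"
      by (rule suminf_le[OF le norm_summable sums_summable[OF sums]])
    also have "\<dots> = norm y * (2 * C)"
      using sums_unique[OF sums] by (simp only: mult_ac)
    finally show ?thesis .
  qed
  then show ?thesis
    using \<open>linear T\<close> by (auto simp: bounded_linear_def bounded_linear_axioms_def)
qed

section \<open>Right inverses of surjections with split kernel\<close>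

text \<open>The closed complement \<open>W\<close> of the kernel meets each fibre of
  \<open>D\<close> in exactly one point, and \<open>A\<close> selects it. Its graph is closed
  because \<open>W\<close> is closed and \<open>D\<close> is continuous.\<close>

lemma bounded_right_inverse:
  fixes D :: "'a::banach \<Rightarrow> 'b::banach"
  assumes "bounded_linear D" "surj D" "complemented (null_space D)"
  obtains A where "bounded_linear A" "\<And>y. D (A y) = y"
proof -
  interpret D: bounded_linear D by fact
  obtain W where W: "subspace W" "closed W" "null_space D \<inter> W = {0}"
    and span: "{v + w | v w. v \<in> null_space D \<and> w \<in> W} = UNIV"
    using assms(3) unfolding complemented_def by blast
  have "\<exists>w. w \<in> W \<and> D w = y" for y
  proof -
    obtain u where "y = D u" using assms(2) by blast
    moreover have "u \<in> {v + w | v w. v \<in> null_space D \<and> w \<in> W}" using span by simp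
    then obtain v w where "u = v + w" "D v = 0" "w \<in> W"
      by (auto simp: null_space_def)
    ultimately show ?thesis by (auto simp: D.add)
  qed
  then obtain A where A: "\<And>y. A y \<in> W" and DA: "\<And>y. D (A y) = y"
    by metis
  \<comment> \<open>This characterization of \<open>A y\<close> yields both linearity and the closed
    graph.\<close>
  have A_eqI: "A y = w" if "w \<in> W" "D w = y" for y w
  proof -
    have "A y - w \<in> null_space D \<inter> W"
      using W(1) A that by (auto simp: null_space_def D.diff DA subspace_diff)
    then show ?thesis using W(3) by simp
  qed
  have "linear A"
    by (intro linearI A_eqI)
      (simp_all add: A DA D.add D.scaleR subspace_add[OF W(1)] subspace_scale[OF W(1)])
  moreover have "A x = y" if "X \<longlonglongrightarrow> x" "(\<lambda>n. A (X n)) \<longlonglongrightarrow> y" for X x y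
  proof (rule A_eqI)
    show "y \<in> W"
      using closed_sequentially[OF W(2) _ that(2)] A by blast
    have "X \<longlonglongrightarrow> D y"
      using D.tendsto[OF that(2)] by (simp add: DA)
    then show "D y = x"
      using that(1) LIMSEQ_unique by blast
  qed
  ultimately have "bounded_linear A"
    by (rule closed_graph_theorem)
  then show thesis using DA that by blast
qed

section \<open>Inverse function theorem at a point with identity derivative\<close>

text \<open>A solution of \<open>N w = v\<close> is a fixed point of
  \<open>w \<mapsto> v + w - N w\<close>, a contraction with factor 1/2. The estimate
  \<open>norm w \<le> 2 * norm (N w)\<close> gives injectivity and the bound on the inverse.\<close>

lemma blinfun_near_id_inverse:
  fixes N :: "'a::banach \<Rightarrow>\<^sub>L 'a"
  assumes "norm (N - id_blinfun) \<le> 1/2"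
  obtains J where "N o\<^sub>L J = id_blinfun" "J o\<^sub>L N = id_blinfun" "norm J \<le> 2"
proof -
  have close: "norm (N w - w) \<le> norm w / 2" for w
    using norm_blinfun[of "N - id_blinfun" w] mult_right_mono[OF assms, of "norm w"]
    by (simp add: blinfun.diff_left)
  have expand: "norm w \<le> 2 * norm (N w)" for w
    using close[of w] norm_triangle_sub[of w "N w"] by (simp add: norm_minus_commute)
  have "\<exists>w. N w = v" for v
  proof -
    have "dist (v + w - N w) (v + z - N z) \<le> 1/2 * dist w z" for w z
    proof -
      have "v + w - N w - (v + z - N z) = - (N (w - z) - (w - z))"
        by (simp add: blinfun.diff_right)
      then show ?thesis
        using close[of "w - z"] by (simp only: dist_norm norm_minus_cancel)
    qed
    then have "\<exists>!w. v + w - N w = w"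
      by (intro banach_fix_type[of "1/2"]) auto
    then show ?thesis by (auto simp: algebra_simps)
  qed
  then obtain j where Nj: "\<And>v. N (j v) = v" by metis
  have jN: "j (N w) = w" for w
    using expand[of "j (N w) - w"] by (simp add: blinfun.diff_right Nj)
  have "bounded_linear j"
  proof (rule bounded_linear_intro[where K = 2])
    show "j (v + w) = j v + j w" for v w
      by (metis Nj jN blinfun.add_right)
    show "j (r *\<^sub>R v) = r *\<^sub>R j v" for r v
      by (metis Nj jN blinfun.scaleR_right)
    show "norm (j v) \<le> norm v * 2" for v
      using expand[of "j v"] by (simp add: Nj)
  qed
  then have J: "Blinfun j v = j v" for v
    by (simp add: bounded_linear_Blinfun_apply)
  show thesis
  proof
    show "N o\<^sub>L Blinfun j = id_blinfun" "Blinfun j o\<^sub>L N = id_blinfun"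
      by (auto intro!: blinfun_eqI simp: J Nj jN)
    show "norm (Blinfun j) \<le> 2"
      by (rule norm_blinfun_bound) (simp, metis expand Nj J)
  qed
qed

text \<open>Near \<open>x0\<close> the map \<open>f - id\<close> is a contraction with factor 1/2,
  so \<open>f x = y\<close> can be solved by Banach's fixed point theorem. The continuous derivative
  \<open>h'\<close> is part of the conclusion because curves built from \<open>h\<close> have to be
  \<open>C1\<close>.\<close>

lemma C1_local_right_inverse:
  fixes f :: "'a::banach \<Rightarrow> 'a" and f' :: "'a \<Rightarrow> 'a \<Rightarrow>\<^sub>L 'a"
  assumes "open U" "x0 \<in> U"
    and derf: "\<And>x. x \<in> U \<Longrightarrow> (f has_derivative f' x) (at x)"
    and contf': "continuous_on U f'"
    and id: "f' x0 = id_blinfun"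
  obtains V h h' where "open V" "f x0 \<in> V" "h (f x0) = x0"
    "\<And>y. y \<in> V \<Longrightarrow> h y \<in> U" "\<And>y. y \<in> V \<Longrightarrow> f (h y) = y"
    "\<And>y. y \<in> V \<Longrightarrow> (h has_derivative blinfun_apply (h' y)) (at y)"
    "\<And>y. y \<in> V \<Longrightarrow> f' (h y) o\<^sub>L h' y = id_blinfun"
    "continuous_on V h'"
proof -
  obtain d1 where d1: "d1 > 0" "cball x0 d1 \<subseteq> U"
    using assms(1,2) open_contains_cball by blast
  obtain d2 where d2: "d2 > 0" "\<And>x. x \<in> U \<Longrightarrow> dist x x0 < d2 \<Longrightarrow> dist (f' x) (f' x0) < 1/2"
    using contf' \<open>x0 \<in> U\<close> unfolding continuous_on_iff by (metis zero_less_divide_1_iff zero_less_numeral)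
  \<comment> \<open>Halving \<open>d2\<close> keeps the closed ball of radius \<open>d\<close>
    inside the open ball of radius \<open>d2\<close>; a closed ball is wanted for
    completeness.\<close>
  define d where "d = min d1 (d2/2)"
  have "d > 0" using d1 d2 by (simp add: d_def)
  have dU: "cball x0 d \<subseteq> U" using d1 by (auto simp: d_def)
  have near: "norm (f' x - id_blinfun) \<le> 1/2" if "x \<in> cball x0 d" for x
  proof -
    have "dist x x0 < d2"
      using that \<open>d2 > 0\<close> by (simp add: d_def dist_commute)
    then show ?thesis
      using d2(2)[of x] that dU id by (auto simp: dist_norm)
  qed
  have contr: "norm ((f x - x) - (f z - z)) \<le> 1/2 * norm (x - z)"
    if "x \<in> cball x0 d" "z \<in> cball x0 d" for x z
  \<comment> \<open>Mean value inequality for \<open>f - id\<close> on the convex ball.\<close>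
  proof (rule differentiable_bound[where f' = "\<lambda>x. blinfun_apply (f' x - id_blinfun)", OF _ _ _ that])
    fix w assume w: "w \<in> cball x0 d"
    then have "(f has_derivative f' w) (at w within cball x0 d)"
      using derf dU has_derivative_at_withinI by blast
    then show "((\<lambda>x. f x - x) has_derivative blinfun_apply (f' w - id_blinfun)) (at w within cball x0 d)"
      by (auto intro!: derivative_eq_intros simp: blinfun.diff_left)
    show "onorm (blinfun_apply (f' w - id_blinfun)) \<le> 1/2"
      using near[OF w] by (simp add: norm_blinfun.rep_eq)
  qed simp
  have expand: "norm (x - z) \<le> 2 * norm (f x - f z)"
    if "x \<in> cball x0 d" "z \<in> cball x0 d" for x z
  proof -
    have "x - z = (f x - f z) - ((f x - x) - (f z - z))" by simp
    then have "norm (x - z) \<le> norm (f x - f z) + norm ((f x - x) - (f z - z))"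
      using norm_triangle_ineq4 by metis
    then show ?thesis using contr[OF that] by simp
  qed
  \<comment> \<open>With this radius \<open>x \<mapsto> x + (y - f x)\<close> maps
    \<open>cball x0 d\<close> into itself: the contraction contributes at most \<open>d / 2\<close>,
    and \<open>y - f x0\<close> less than \<open>d / 2\<close>.\<close>
  define V where "V = ball (f x0) (d/2)"
  have "\<exists>x\<in>cball x0 d. f x = y" if "y \<in> V" for y
  proof -
    let ?u = "\<lambda>x. x + (y - f x)"
    have diff: "?u x - ?u z = - ((f x - x) - (f z - z))" for x z
      by simp
    have "\<exists>!x. x \<in> cball x0 d \<and> ?u x = x"
    proof (rule Banach_fix)
      show "complete (cball x0 d)" by (simp add: complete_eq_closed)
      show "?u ` cball x0 d \<subseteq> cball x0 d"
      proof clarify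
        fix x assume x: "x \<in> cball x0 d"
        have "norm (?u x - ?u x0) \<le> d / 2"
          using contr[OF x, of x0] x \<open>d > 0\<close>
          unfolding diff norm_minus_cancel by (simp add: dist_norm norm_minus_commute)
        moreover have "?u x - x0 = (?u x - ?u x0) + (y - f x0)" by simp
        then have "norm (?u x - x0) \<le> norm (?u x - ?u x0) + norm (y - f x0)"
          using norm_triangle_ineq by metis
        moreover have "norm (y - f x0) < d / 2"
          using \<open>y \<in> V\<close> by (simp add: V_def dist_norm norm_minus_commute)
        ultimately have "norm (?u x - x0) \<le> d" by linarith
        then show "?u x \<in> cball x0 d"
          by (simp only: mem_cball dist_norm norm_minus_commute)
      qed
      show "dist (?u x) (?u z) \<le> 1/2 * dist x z"
        if "x \<in> cball x0 d" "z \<in> cball x0 d" for x z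
        using contr[OF that] unfolding dist_norm diff norm_minus_cancel .
    qed (use \<open>d > 0\<close> in auto)
    then obtain x where "x \<in> cball x0 d" "?u x = x" by blast
    then show ?thesis by (intro bexI[of _ x]) simp_all
  qed
  then obtain h where h: "\<And>y. y \<in> V \<Longrightarrow> h y \<in> cball x0 d" and fh: "\<And>y. y \<in> V \<Longrightarrow> f (h y) = y"
    by metis
  have "open V" "f x0 \<in> V" using \<open>d > 0\<close> by (auto simp: V_def)
  have "h (f x0) = x0"
    using expand[OF h[OF \<open>f x0 \<in> V\<close>], of x0] \<open>d > 0\<close> \<open>f x0 \<in> V\<close> by (simp add: fh)
  \<comment> \<open>The lower bound \<open>expand\<close> for \<open>f\<close> is a Lipschitz bound
    for \<open>h\<close>. The resulting continuity is needed both to differentiate \<open>h\<close>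
    and to make \<open>f' (h y)\<close> continuous in \<open>y\<close>.\<close>
  have "2-lipschitz_on V h"
    by (rule lipschitz_onI) (use expand[OF h h] in \<open>simp_all add: dist_norm fh\<close>)
  then have conth: "continuous_on V h"
    by (rule lipschitz_on_continuous_on)
  have "\<exists>J. f' (h y) o\<^sub>L J = id_blinfun \<and> J o\<^sub>L f' (h y) = id_blinfun \<and> norm J \<le> 2" if "y \<in> V" for y
    using blinfun_near_id_inverse[OF near[OF h[OF that]]] by metis
  then obtain h' where h': "\<And>y. y \<in> V \<Longrightarrow> f' (h y) o\<^sub>L h' y = id_blinfun"
      "\<And>y. y \<in> V \<Longrightarrow> h' y o\<^sub>L f' (h y) = id_blinfun" "\<And>y. y \<in> V \<Longrightarrow> norm (h' y) \<le> 2"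
    by metis
  have derh: "(h has_derivative h' y) (at y)" if "y \<in> V" for y
  proof (rule has_derivative_inverse_basic[OF derf _ _ _ \<open>open V\<close> that])
    show "h y \<in> U" using h[OF that] dU by blast
    show "bounded_linear (h' y)" by (rule blinfun.bounded_linear_right)
    show "blinfun_apply (h' y) \<circ> blinfun_apply (f' (h y)) = id"
      using arg_cong[OF h'(2)[OF that], of blinfun_apply] by (simp add: fun_eq_iff)
    show "continuous (at y) h"
      using conth \<open>open V\<close> that continuous_on_eq_continuous_at by blast
  qed (use fh in auto)
  have contN: "continuous_on V (\<lambda>y. f' (h y))"
    by (rule continuous_on_compose2[OF contf' conth]) (use h dU in blast)
  have "continuous_on V h'"
    unfolding continuous_on_def
  proof
    fix z assume z: "z \<in> V"
    \<comment> \<open>Resolvent identity: \<open>N\<^sub>y\<inverse> - N\<^sub>z\<inverse> = N\<^sub>y\<inverse> (N\<^sub>z - N\<^sub>y) N\<^sub>z\<inverse>\<close>.\<close>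
    have "norm (h' y - h' z) \<le> 4 * norm (f' (h z) - f' (h y))" if y: "y \<in> V" for y
    proof -
      have "h' y - h' z = h' y o\<^sub>L (f' (h z) - f' (h y)) o\<^sub>L h' z"
      proof (rule blinfun_eqI)
        fix v
        have "h' y (f' (h y) (h' z v)) = h' z v" "f' (h z) (h' z v) = v"
          using h'(2)[OF y] h'(1)[OF z]
          by (metis blinfun_apply_blinfun_compose blinfun_apply_id_blinfun)+
        then show "(h' y - h' z) v = (h' y o\<^sub>L (f' (h z) - f' (h y)) o\<^sub>L h' z) v"
          by (simp add: blinfun.diff_left blinfun.diff_right)
      qed
      then have "norm (h' y - h' z) \<le> norm (h' y o\<^sub>L (f' (h z) - f' (h y))) * norm (h' z)"
        by (simp only: norm_blinfun_compose)
      also have "\<dots> \<le> (norm (h' y) * norm (f' (h z) - f' (h y))) * norm (h' z)"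
        by (intro mult_right_mono norm_blinfun_compose norm_ge_zero)
      also have "\<dots> \<le> (2 * norm (f' (h z) - f' (h y))) * 2"
        by (intro mult_mono h'(3) y z) auto
      finally show ?thesis by simp
    qed
    then have "\<forall>\<^sub>F y in at z within V. norm (h' y - h' z) \<le> 4 * norm (f' (h z) - f' (h y))"
      by (simp add: eventually_at_filter)
    moreover have "((\<lambda>y. f' (h y)) \<longlongrightarrow> f' (h z)) (at z within V)"
      using contN z by (simp add: continuous_on_def)
    then have "((\<lambda>y. 4 * norm (f' (h z) - f' (h y))) \<longlongrightarrow> 4 * norm (f' (h z) - f' (h z))) (at z within V)"
      by (intro tendsto_intros)
    then have "((\<lambda>y. 4 * norm (f' (h z) - f' (h y))) \<longlongrightarrow> 0) (at z within V)"
      by simp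
    ultimately have "((\<lambda>y. h' y - h' z) \<longlongrightarrow> 0) (at z within V)"
      by (rule Lim_null_comparison)
    then show "(h' \<longlongrightarrow> h' z) (at z within V)"
      by (simp add: LIM_zero_iff)
  qed
  then show thesis
    using that \<open>open V\<close> \<open>f x0 \<in> V\<close> \<open>h (f x0) = x0\<close> h dU fh derh h'(1) by blast
qed

section \<open>Curves in the level set with prescribed velocity\<close>

text \<open>This is the inclusion of the null space of the derivative in the tangent space of the
  level set, in the form in which criticality can be applied to it.\<close>

lemma level_set_curve:
  fixes g :: "'a::banach \<Rightarrow> 'b::banach"
  assumes "open U" "C1_on g U" "x \<in> level_set U g y0" "regular_point U g x"
    and v: "frechet_derivative g (at x) v = 0"
  obtains \<epsilon> c where "\<epsilon> > 0" "c C1_differentiable_on {-\<epsilon><..<\<epsilon>}"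
    "c ` {-\<epsilon><..<\<epsilon>} \<subseteq> level_set U g y0" "c 0 = x" "(c has_vector_derivative v) (at 0)"
proof -
  have "x \<in> U" "g x = y0" using assms(3) by (auto simp: level_set_def)
  obtain g' :: "'a \<Rightarrow> 'a \<Rightarrow>\<^sub>L 'b" where derg: "\<And>x. x \<in> U \<Longrightarrow> (g has_derivative g' x) (at x)"
    and contg': "continuous_on U g'"
    using assms(2) unfolding C1_on_def by blast
  have D: "frechet_derivative g (at x) = g' x"
    using frechet_derivative_at[OF derg[OF \<open>x \<in> U\<close>]] by simp
  obtain a where "bounded_linear a" "\<And>y. g' x (a y) = y"
    using bounded_right_inverse[OF blinfun.bounded_linear_right[of "g' x"]] assms(4)
    unfolding regular_point_def D by metis
  then obtain A where DA: "g' x (blinfun_apply A y) = y" for y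
    using bounded_linear_Blinfun_apply by metis
  \<comment> \<open>\<open>\<phi>\<close> straightens the level set: it maps it into the kernel of \<open>g' x\<close>.\<close>
  define \<phi> where "\<phi> z = z - x - A (g' x (z - x)) + A (g z - y0)" for z
  define \<phi>' where "\<phi>' z = id_blinfun - (A o\<^sub>L g' x) + (A o\<^sub>L g' z)" for z
  have der\<phi>: "(\<phi> has_derivative \<phi>' z) (at z)" if "z \<in> U" for z
    unfolding \<phi>_def \<phi>'_def
    by (auto intro!: derivative_eq_intros derg[OF that] ext simp: blinfun.bilinear_simps)
  have cont\<phi>': "continuous_on U \<phi>'"
    unfolding \<phi>'_def by (intro continuous_intros contg')
  have id: "\<phi>' x = id_blinfun" by (simp add: \<phi>'_def)
  have \<phi>x: "\<phi> x = 0" by (simp add: \<phi>_def \<open>g x = y0\<close> blinfun.zero_right)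
  obtain V h h' where V: "open V" "0 \<in> V" "h 0 = x"
    and hU: "\<And>y. y \<in> V \<Longrightarrow> h y \<in> U" and \<phi>h: "\<And>y. y \<in> V \<Longrightarrow> \<phi> (h y) = y"
    and derh: "\<And>y. y \<in> V \<Longrightarrow> (h has_derivative blinfun_apply (h' y)) (at y)"
    and h': "\<And>y. y \<in> V \<Longrightarrow> \<phi>' (h y) o\<^sub>L h' y = id_blinfun" and conth': "continuous_on V h'"
    using C1_local_right_inverse[OF \<open>open U\<close> \<open>x \<in> U\<close> der\<phi> cont\<phi>' id] unfolding \<phi>x by metis
  have "open ((\<lambda>t. t *\<^sub>R v) -` V)"
    by (intro open_vimage V continuous_intros)
  moreover have "(0::real) \<in> (\<lambda>t. t *\<^sub>R v) -` V" using V by simp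
  ultimately obtain \<epsilon> where "\<epsilon> > 0" and "ball 0 \<epsilon> \<subseteq> (\<lambda>t. t *\<^sub>R v) -` V"
    unfolding open_contains_ball by blast
  then have \<epsilon>: "t *\<^sub>R v \<in> V" if "t \<in> {-\<epsilon><..<\<epsilon>}" for t
    using that by (force simp: dist_norm)
  define c where "c t = h (t *\<^sub>R v)" for t :: real
  have derc: "(c has_vector_derivative h' (t *\<^sub>R v) v) (at t)" if "t \<in> {-\<epsilon><..<\<epsilon>}" for t
  proof -
    have "((\<lambda>t. t *\<^sub>R v) has_derivative (\<lambda>t. t *\<^sub>R v)) (at t)"
      by (auto intro!: derivative_eq_intros)
    from has_derivative_compose[OF this derh[OF \<epsilon>[OF that]]] show ?thesis
      by (simp add: has_vector_derivative_def c_def[abs_def] blinfun.scaleR_right)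
  qed
  show thesis
  proof
    show "\<epsilon> > 0" by fact
    have "continuous_on {-\<epsilon><..<\<epsilon>} (\<lambda>t. h' (t *\<^sub>R v))"
      by (rule continuous_on_compose2[OF conth']) (auto intro!: continuous_intros \<epsilon>)
    then have "continuous_on {-\<epsilon><..<\<epsilon>} (\<lambda>t. h' (t *\<^sub>R v) v)"
      by (intro continuous_intros)
    then show "c C1_differentiable_on {-\<epsilon><..<\<epsilon>}"
      unfolding C1_differentiable_on_def
      by (intro exI[of _ "\<lambda>t. h' (t *\<^sub>R v) v"] conjI ballI derc)
    show "c ` {-\<epsilon><..<\<epsilon>} \<subseteq> level_set U g y0"
    proof clarify
      fix t assume t: "t \<in> {-\<epsilon><..<\<epsilon>}"
      \<comment> \<open>Applying \<open>g' x\<close> to \<open>\<phi> z\<close> cancels the two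
        linear terms, since \<open>A\<close> is a right inverse. Moreover
        \<open>\<phi> (c t)\<close> is \<open>t *\<^sub>R v\<close>, which lies in the
        kernel.\<close>
      have "g (c t) - y0 = g' x (\<phi> (c t))"
        by (simp add: \<phi>_def blinfun.bilinear_simps DA)
      also have "\<dots> = 0"
        using \<phi>h[OF \<epsilon>[OF t]] v unfolding D by (simp add: c_def blinfun.scaleR_right)
      finally show "c t \<in> level_set U g y0"
        using hU[OF \<epsilon>[OF t]] by (simp add: level_set_def c_def)
    qed
    show "c 0 = x" by (simp add: c_def V)
    \<comment> \<open>\<open>h' 0\<close> is a right inverse of \<open>\<phi>' x\<close>, which is
      the identity; hence the initial velocity is \<open>v\<close> itself.\<close>
    have "h' 0 = id_blinfun"
      using h'[of 0] by (intro blinfun_eqI) (metis V(2,3) id blinfun_apply_blinfun_compose blinfun_apply_id_blinfun)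
    then show "(c has_vector_derivative v) (at 0)"
      using derc[of 0] \<open>\<epsilon> > 0\<close> by simp
  qed
qed

section \<open>Existence and uniqueness of the multiplier\<close>

theorem theorem3p2:
  fixes U :: "'a::banach set" and g :: "'a \<Rightarrow> 'b::banach" and f :: "'a \<Rightarrow> real"
    and y0 :: 'b and x :: 'a
  assumes "open U"
    and "C1_on g U"
    and "C1_on f U"
    and "regular_value U g y0"
    and "critical_point_on f (level_set U g y0) x"
  shows "\<exists>!L :: 'b \<Rightarrow>\<^sub>L real. lagrange_multiplier U f g y0 x L"
proof -
  have S: "x \<in> level_set U g y0"
    using assms(5) by (simp add: critical_point_on_def)
  then have "x \<in> U" "g x = y0" by (auto simp: level_set_def)
  have reg: "regular_point U g x"
    using S assms(4) by (simp add: regular_value_def)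
  let ?Df = "frechet_derivative f (at x)" and ?Dg = "frechet_derivative g (at x)"
  have derf: "(f has_derivative ?Df) (at x)" and derg: "(g has_derivative ?Dg) (at x)"
    using assms(2,3) \<open>x \<in> U\<close> unfolding C1_on_def
    by (meson differentiableI frechet_derivative_works)+
  interpret Df: bounded_linear ?Df by (rule has_derivative_bounded_linear[OF derf])
  interpret Dg: bounded_linear ?Dg by (rule has_derivative_bounded_linear[OF derg])
  have ker: "?Df v = 0" if v: "?Dg v = 0" for v
  proof -
    obtain \<epsilon> c where c: "\<epsilon> > 0" "c C1_differentiable_on {-\<epsilon><..<\<epsilon>}"
      "c ` {-\<epsilon><..<\<epsilon>} \<subseteq> level_set U g y0" "c 0 = x" "(c has_vector_derivative v) (at 0)"
      using level_set_curve[OF assms(1,2) S reg v] .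
    have "((\<lambda>t. f (c t)) has_real_derivative 0) (at 0)"
      using assms(5) c unfolding critical_point_on_def by blast
    \<comment> \<open>The chain rule gives a second derivative of the same function at 0; comparing
      the two at the argument 1 gives the claim.\<close>
    moreover have "((\<lambda>t. f (c t)) has_derivative (\<lambda>t. ?Df (t *\<^sub>R v))) (at 0)"
      using has_derivative_compose[of c _ 0 UNIV f] c derf by (simp add: has_vector_derivative_def)
    ultimately have "(\<lambda>t. ?Df (t *\<^sub>R v)) = (*) 0"
      unfolding has_field_derivative_def by (rule has_derivative_unique[rotated])
    from fun_cong[OF this, of 1] show ?thesis by simp
  qed
  obtain A where A: "bounded_linear A" and DA: "\<And>y. ?Dg (A y) = y"
    using bounded_right_inverse[OF Dg.bounded_linear_axioms] reg
    unfolding regular_point_def by metis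
  define L where "L = Blinfun (\<lambda>y. ?Df (A y))"
  have L: "L y = ?Df (A y)" for y
    unfolding L_def
    by (simp add: bounded_linear_Blinfun_apply bounded_linear_compose[OF Df.bounded_linear_axioms A])
  \<comment> \<open>The vector \<open>v - A (?Dg v)\<close> lies in the kernel of
    \<open>?Dg\<close>, so \<open>?Df\<close> vanishes on it.\<close>
  have "?Df v - L (?Dg v) = 0" for v
    using ker[of "v - A (?Dg v)"] by (simp add: L Dg.diff Df.diff DA)
  then have "lagrange_multiplier U f g y0 x L"
    using \<open>x \<in> U\<close> \<open>g x = y0\<close> by (simp add: lagrange_multiplier_def)
  moreover have "M = L" if "lagrange_multiplier U f g y0 x M" for M
  proof (rule blinfun_eqI)
    fix y
    \<comment> \<open>Testing the Euler equation at \<open>A y\<close> determines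
      \<open>M y\<close>, because \<open>?Dg (A y) = y\<close>.\<close>
    have "?Df (A y) - M (?Dg (A y)) = 0"
      using that unfolding lagrange_multiplier_def by blast
    then show "M y = L y" by (simp add: DA L)
  qed
  ultimately show ?thesis by blast
qed

end
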